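(* Let $x\in(0,1)$ be irrational with regular continued fraction convergent denominators $(Q_n)_{n\ge0}$. (i) Let $\Omega$ be a bounded complex-valued function on $[-1,1]$, differentiable at $1$ and at $-1$, and let $\alpha>0$. Then the series $$\sum_{j=1}^{\infty}e^{i\frac{\pi}{4}\sum_{\ell=0}^{j-1}\sigma(T^\ell x)}\,|xT(x)\cdots T^{j-1}(x)|^{\alpha}\,\Omega\big(T^j(x)\big)$$ converges. (ii) Let $\alpha>0$ and $\beta\in\mathbb R$. If $\sum_{n=1}^\infty\frac{Q_{n+1}^\beta}{Q_n^{\alpha+\beta}}<\infty$, then the series $$\sum_{j=0}^{\infty}e^{i\frac{\pi}{4}\sum_{\ell=0}^{j-1}\sigma(T^\ell x)}\,\frac{|xT(x)\cdots T^{j-1}(x)|^{\alpha}}{|T^j(x)|^\beta}$$ converges. (iii) Let $\alpha>0$. If $\sum_{n=1}^\infty\frac{\log(Q_{n+1})}{Q_n^\alpha}<\infty$, then the series $$\sum_{j=0}^{\infty}e^{i\frac{\pi}{4}\sum_{\ell=0}^{j-1}\sigma(T^\ell x)}\,|xT(x)\cdots T^{j-1}(x)|^{\alpha}\log\Big(\frac1{|T^j(x)|}\Big)$$ converges.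
   Context: $T:[-1,1]\setminus\{0\}\to[-1,1]$ is $T(x)=-\frac1x\bmod 2$, i.e. $T(x)=-\frac1x-2m$ with $m\in\mathbb Z$ chosen so that the value lies in $(-1,1]$; $T^j$ is its $j$-th iterate; for $j=0$ the product $xT(x)\cdots T^{j-1}(x)$ is $1$ and the sum $\sum_{\ell=0}^{j-1}$ is $0$. $\sigma(y)$ is the sign of $y$ ($\pm1$). $Q_n$: denominators of the regular continued fraction convergents of $x$ ($Q_{-1}=0,Q_0=1,Q_{n+1}=A_{n+1}Q_n+Q_{n-1}$). *)

theory Defs
  imports "HOL-Analysis.Analysis"
begin

text \<open>The ceiling is the unique integer \<open>m\<close> with \<open>-1/x - 2m \<in> (-1,1]\<close>, see
  \<open>even_map_unique\<close> below. The value at \<open>0\<close>, where the map is undefined, is irrelevant: orbits of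
  irrational points avoid \<open>0\<close>, see \<open>even_map_iter_irrational\<close>.\<close>

definition even_map :: "real \<Rightarrow> real" where
  "even_map x = - 1 / x - 2 * of_int \<lceil>(- 1 / x - 1) / 2\<rceil>"

definition orbit_prod :: "real \<Rightarrow> nat \<Rightarrow> real" where
  "orbit_prod x j = (\<Prod>l<j. (even_map ^^ l) x)"

definition orbit_phase :: "real \<Rightarrow> nat \<Rightarrow> complex" where
  "orbit_phase x j =
     exp (\<i> * of_real (pi / 4) * of_real (\<Sum>l<j. sgn ((even_map ^^ l) x)))"

text \<open>Regular continued fraction \<open>x = [A\<^sub>0; A\<^sub>1, A\<^sub>2, \<dots>]\<close>: complete quotients, partial quotients
  and denominators of the convergents. The equation for \<open>Q\<^sub>1\<close> is the recurrence with
  \<open>Q\<^bsub>-1\<^esub> = 0\<close>, \<open>Q\<^sub>0 = 1\<close>.\<close>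

primrec rcf_complete :: "real \<Rightarrow> nat \<Rightarrow> real" where
  "rcf_complete x 0 = x"
| "rcf_complete x (Suc n) = 1 / frac (rcf_complete x n)"

definition rcf_partial :: "real \<Rightarrow> nat \<Rightarrow> int" where
  "rcf_partial x n = \<lfloor>rcf_complete x n\<rfloor>"

fun rcf_denom :: "real \<Rightarrow> nat \<Rightarrow> int" where
  "rcf_denom x 0 = 1"
| "rcf_denom x (Suc 0) = rcf_partial x 1"
| "rcf_denom x (Suc (Suc n)) =
     rcf_partial x (Suc (Suc n)) * rcf_denom x (Suc n) + rcf_denom x n"

lemma even_map_range: "even_map x \<in> {-1<..1}"
proof -
  define y where "y = - 1 / x"
  define r where "r = real_of_int \<lceil>(y - 1) / 2\<rceil>"
  have "even_map x = y - 2 * r"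
    by (simp add: even_map_def y_def r_def)
  moreover have "(y - 1) / 2 \<le> r" "r < (y - 1) / 2 + 1"
    unfolding r_def by linarith+
  ultimately show ?thesis
    by (simp add: field_simps)
qed

lemma even_map_unique:
  assumes "- 1 / x - 2 * of_int m \<in> {-1<..1}"
  shows "even_map x = - 1 / x - 2 * of_int m"
proof -
  have "\<lceil>(- 1 / x - 1) / 2\<rceil> = m"
    using assms by (intro ceiling_unique) (auto simp: field_simps)
  then show ?thesis by (simp add: even_map_def)
qed

lemma even_map_irrational:
  assumes "x \<notin> \<rat>"
  shows "even_map x \<notin> \<rat>"
proof
  assume "even_map x \<in> \<rat>"
  then have "even_map x + 2 * of_int \<lceil>(- 1 / x - 1) / 2\<rceil> \<in> \<rat>"
    by (intro Rats_add Rats_mult) auto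
  then have "- 1 / x \<in> \<rat>" by (simp add: even_map_def)
  then have "- 1 / (- 1 / x) \<in> \<rat>" by (rule Rats_divide[rotated]) auto
  moreover have "- 1 / (- 1 / x) = x" by simp
  ultimately show False using assms by metis
qed

lemma even_map_iter_irrational:
  assumes "x \<notin> \<rat>"
  shows "(even_map ^^ j) x \<notin> \<rat>"
  by (induction j) (simp_all add: assms even_map_irrational)

end

theory Submission
  imports Defs
begin

text \<open>Write \<open>x\<^sub>j\<close> for the orbit, \<open>s\<^sub>j\<close> for the product of the first \<open>j\<close> orbit points and
  \<open>e\<^sub>j\<close> for the phase. Since \<open>e\<^sub>j = (e\<^bsub>j+1\<^esub> - e\<^sub>j) / (e\<^bsup>\<plusminus>i\<pi>/4\<^esup> - 1)\<close>, summation by parts applies as soon as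
  \<open>|s\<^sub>j|\<^sup>\<alpha>\<close>, multiplied by any function of the sign of \<open>x\<^sub>j\<close>, has bounded variation. It does:
  \<open>|s\<^sub>j|\<^sup>\<alpha>\<close> decreases to \<open>0\<close>, and the sign can change only when \<open>|x\<^sub>j| \<le> 1/2\<close>, in which case \<open>|s\<^sub>j|\<^sup>\<alpha>\<close> itself is
  comparable to its decrement. Replacing \<open>\<Omega>(x\<^sub>j)\<close> by \<open>\<Omega>(\<plusminus>1)\<close> costs
  \<open>O(|s\<^sub>j|\<^sup>\<alpha> (1 - |x\<^sub>j|))\<close>, which is again bounded by the decrement; this gives (i).

  For (ii) and (iii) only the indices with \<open>|x\<^sub>j| < 1/4\<close> remain, where the sum converges absolutely.
  There \<open>s\<^bsub>j+1\<^esub> = q x - p\<close> with integers satisfying \<open>|q| |q x - p| < 1/2\<close>, so by Legendre's argument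
  \<open>p/q\<close> is a regular convergent \<open>P\<^sub>n/Q\<^sub>n\<close>, distinct \<open>j\<close> give distinct \<open>n\<close>, and
  \<open>|s\<^sub>j| \<le> (4/3) / Q\<^sub>n\<close>, \<open>|s\<^bsub>j+1\<^esub>| \<ge> 1 / (2 Q\<^bsub>n+1\<^esub>)\<close>.\<close>

section \<open>Elementary inequalities\<close>

lemma one_minus_powr_ge:
  fixes t \<alpha> :: real
  assumes "0 < t" "t \<le> 1" "0 < \<alpha>"
  shows "min 1 \<alpha> * (1 - t) \<le> 1 - t powr \<alpha>"
proof (cases "\<alpha> \<ge> 1")
  case True
  then have "t powr \<alpha> \<le> t powr 1"
    using assms by (intro powr_mono') auto
  then show ?thesis using True assms by simp
next
  case False
  \<comment> \<open>For \<alpha> < 1 the bound is weighted AM-GM for 1 and \<open>t\<close>, read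
    off from the convexity of \<open>exp\<close> between 0 and \<open>ln t\<close>.\<close>
  have "exp ((1 - \<alpha>) *\<^sub>R 0 + \<alpha> *\<^sub>R ln t) \<le> (1 - \<alpha>) * exp 0 + \<alpha> * exp (ln t)"
    using False assms by (intro convex_onD[OF exp_convex]) auto
  then have "t powr \<alpha> \<le> (1 - \<alpha>) + \<alpha> * t"
    using assms by (simp add: powr_def)
  then show ?thesis using False by (simp add: algebra_simps)
qed

text \<open>Close to \<open>c\<close> the derivative controls the increment. At distance at least
  \<open>d\<close> boundedness does, since \<open>2 * B\<close> is then at most
  \<open>2 * B / d\<close> times the distance.\<close>

lemma differentiable_bounded_imp_lipschitz_at:
  fixes f :: "real \<Rightarrow> complex"
  assumes bdd: "bounded (f ` S)" and diff: "f differentiable (at c within S)" and "c \<in> S"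
  shows "\<exists>K\<ge>0. \<forall>y\<in>S. norm (f y - f c) \<le> K * \<bar>y - c\<bar>"
proof -
  obtain B where B: "\<And>y. y \<in> S \<Longrightarrow> norm (f y) \<le> B"
    using bdd by (auto simp: bounded_iff)
  obtain f' where f': "(f has_derivative f') (at c within S)"
    using diff by (auto simp: differentiable_def)
  obtain L where L: "\<And>h. norm (f' h) \<le> norm h * L"
    using bounded_linear.bounded[OF has_derivative_bounded_linear[OF f']] by blast
  obtain d where "d > 0" and
    d: "\<And>y. y \<in> S \<Longrightarrow> norm (y - c) < d \<Longrightarrow> norm (f y - f c - f' (y - c)) \<le> 1 * norm (y - c)"
    using f' unfolding has_derivative_within_alt by (meson zero_less_one)
  have "B \<ge> 0" using B[OF \<open>c \<in> S\<close>] norm_ge_zero order_trans by blast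
  define K where "K = 1 + \<bar>L\<bar> + 2 * B / d"
  have "norm (f y - f c) \<le> K * \<bar>y - c\<bar>" if "y \<in> S" for y
  proof (cases "\<bar>y - c\<bar> < d")
    case True
    have "norm (f y - f c) \<le> norm (f y - f c - f' (y - c)) + norm (f' (y - c))"
      using norm_triangle_ineq[of "f y - f c - f' (y - c)" "f' (y - c)"] by simp
    also have "\<dots> \<le> \<bar>y - c\<bar> + \<bar>y - c\<bar> * L"
      using d[OF that] True L[of "y - c"] by (intro add_mono) auto
    also have "\<dots> = (1 + L) * \<bar>y - c\<bar>" by (simp add: algebra_simps)
    also have "\<dots> \<le> K * \<bar>y - c\<bar>"
      using \<open>B \<ge> 0\<close> \<open>d > 0\<close> unfolding K_def by (intro mult_right_mono) (auto simp: add_increasing2)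
    finally show ?thesis .
  next
    case False
    have "norm (f y - f c) \<le> norm (f y) + norm (f c)" by (rule norm_triangle_ineq4)
    also have "\<dots> \<le> 2 * B" using B[OF that] B[OF \<open>c \<in> S\<close>] by simp
    also have "\<dots> = 2 * B / d * d" using \<open>d > 0\<close> by simp
    also have "\<dots> \<le> K * \<bar>y - c\<bar>"
      using False \<open>B \<ge> 0\<close> \<open>d > 0\<close> unfolding K_def by (intro mult_mono) auto
    finally show ?thesis .
  qed
  moreover have "K \<ge> 0" unfolding K_def using \<open>B \<ge> 0\<close> \<open>d > 0\<close> by simp
  ultimately show ?thesis by blast
qed

section \<open>The map near 1 and -1\<close>

lemma even_map_near_fixed_point:
  assumes "1/2 < \<bar>y\<bar>" "\<bar>y\<bar> < 1"
  shows "even_map y = - 1 / y + 2 * sgn y"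
proof (cases "y > 0")
  case True
  have "even_map y = - 1 / y - 2 * of_int (- 1)"
    using True assms by (intro even_map_unique) (auto simp: field_simps)
  then show ?thesis using True by simp
next
  case False
  have "even_map y = - 1 / y - 2 * of_int 1"
    using False assms by (intro even_map_unique) (auto simp: field_simps)
  then show ?thesis using False assms by (simp add: sgn_if)
qed

lemma sgn_even_map:
  assumes "1/2 < \<bar>y\<bar>" "\<bar>y\<bar> < 1"
  shows "sgn (even_map y) = sgn y"
  using assms by (auto simp: even_map_near_fixed_point[OF assms] sgn_if field_simps split: if_splits)

text \<open>The points 1 and -1 are neutral fixed points of these two branches. Sending them to
  infinity turns such a parabolic map into a translation, which forces orbits to leave their
  neighbourhood.\<close>

lemma inverse_dist_fixed_point_even_map:
  assumes "1/2 < \<bar>y\<bar>" "\<bar>y\<bar> < 1"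
  shows "1 / (1 - \<bar>even_map y\<bar>) = 1 / (1 - \<bar>y\<bar>) - 1"
proof -
  have "\<bar>even_map y\<bar> = 2 - 1 / \<bar>y\<bar>"
    using assms by (auto simp: even_map_near_fixed_point[OF assms] sgn_if abs_if field_simps split: if_splits)
  then have "1 - \<bar>even_map y\<bar> = (1 - \<bar>y\<bar>) / \<bar>y\<bar>"
    using assms by (simp add: field_simps)
  then have "1 / (1 - \<bar>even_map y\<bar>) = \<bar>y\<bar> / (1 - \<bar>y\<bar>)"
    by simp
  also have "\<dots> = 1 / (1 - \<bar>y\<bar>) - 1"
    using assms by (simp add: field_simps)
  finally show ?thesis .
qed

lemma orbit_prod_0 [simp]: "orbit_prod x 0 = 1"
  by (simp add: orbit_prod_def)

lemma orbit_prod_Suc: "orbit_prod x (Suc j) = orbit_prod x j * (even_map ^^ j) x"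
  by (simp add: orbit_prod_def)

lemma orbit_phase_Suc:
  "orbit_phase x (Suc j) = orbit_phase x j * cis (pi / 4 * sgn ((even_map ^^ j) x))"
  by (simp add: orbit_phase_def cis_conv_exp exp_add [symmetric] algebra_simps)

lemma norm_orbit_phase [simp]: "norm (orbit_phase x j) = 1"
proof -
  have "orbit_phase x j = cis (pi / 4 * (\<Sum>l<j. sgn ((even_map ^^ l) x)))"
    by (simp add: orbit_phase_def cis_conv_exp algebra_simps)
  then show ?thesis by simp
qed

text \<open>Numerators of the regular convergents with \<open>A\<^sub>0 = 0\<close> built in, as is
  right for 0 < x < 1.\<close>

fun rcf_numer :: "real \<Rightarrow> nat \<Rightarrow> int" where
  "rcf_numer x 0 = 0"
| "rcf_numer x (Suc 0) = 1"
| "rcf_numer x (Suc (Suc n)) =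
     rcf_partial x (Suc (Suc n)) * rcf_numer x (Suc n) + rcf_numer x n"

text \<open>By injectivity each \<open>F n\<close> is used at most once, so every partial sum stays
  below \<open>C * suminf F\<close>, in whatever order \<nu> visits the indices.\<close>

lemma summable_if_comparison_inj_on:
  fixes f F :: "nat \<Rightarrow> real"
  assumes inj: "inj_on \<nu> S" and le: "\<And>j. j \<in> S \<Longrightarrow> 0 \<le> f j \<and> f j \<le> C * F (\<nu> j)"
    and F: "summable F" "\<And>n. F n \<ge> 0" and "C \<ge> 0"
  shows "summable (\<lambda>j. if j \<in> S then f j else 0)"
proof (rule summableI_nonneg_bounded)
  fix N
  have "(\<Sum>j<N. if j \<in> S then f j else 0) = (\<Sum>j\<in>{..<N} \<inter> S. f j)"
    by (simp add: sum.inter_restrict)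
  also have "\<dots> \<le> (\<Sum>j\<in>{..<N} \<inter> S. C * F (\<nu> j))"
    using le by (intro sum_mono) auto
  also have "\<dots> = C * (\<Sum>n\<in>\<nu> ` ({..<N} \<inter> S). F n)"
    using inj by (subst sum.reindex) (auto simp: sum_distrib_left inj_on_def)
  also have "\<dots> \<le> C * suminf F"
    using F \<open>C \<ge> 0\<close> by (intro mult_left_mono sum_le_suminf) auto
  finally show "(\<Sum>j<N. if j \<in> S then f j else 0) \<le> C * suminf F" .
qed (use le in auto)

section \<open>Orbits of an irrational point and decay of their products\<close>

locale irrational_orbit =
  fixes x :: real
  assumes x_pos: "0 < x" and x_less: "x < 1" and irrational: "x \<notin> \<rat>"
begin

abbreviation T :: "nat \<Rightarrow> real" where "T j \<equiv> (even_map ^^ j) x"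
abbreviation s :: "nat \<Rightarrow> real" where "s j \<equiv> orbit_prod x j"

lemma T_irrational: "T j \<notin> \<rat>"
  using irrational by (rule even_map_iter_irrational)

lemma T_nonzero [simp]: "T j \<noteq> 0"
  using T_irrational[of j] by (metis Rats_0)

lemma abs_T_less [simp]: "\<bar>T j\<bar> < 1"
proof (cases j)
  case 0
  then show ?thesis using x_pos x_less by simp
next
  case (Suc k)
  have "T j \<in> {-1<..1}" using even_map_range[of "T k"] Suc by simp
  moreover have "T j \<noteq> 1" using T_irrational[of j] by (metis Rats_1)
  ultimately show ?thesis by auto
qed

lemma s_nonzero [simp]: "s j \<noteq> 0"
  by (induction j) (auto simp: orbit_prod_Suc)

lemma abs_s_Suc_less: "\<bar>s (Suc j)\<bar> < \<bar>s j\<bar>"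
  using abs_T_less[of j] s_nonzero[of j] by (simp add: orbit_prod_Suc abs_mult mult_less_cancel_left1)

lemma abs_s_strict_antimono: "i < j \<Longrightarrow> \<bar>s j\<bar> < \<bar>s i\<bar>"
proof (induction rule: less_Suc_induct)
  case (1 i) then show ?case by (rule abs_s_Suc_less)
qed simp

text \<open>Otherwise the positive quantity \<open>1 / (1 - \<bar>T j\<bar>)\<close> would drop by 1
  at every step from \<open>N\<close> on.\<close>

lemma not_eventually_near_fixed_point: "\<not> (\<forall>j\<ge>N. 1/2 < \<bar>T j\<bar>)"
proof
  assume near: "\<forall>j\<ge>N. 1/2 < \<bar>T j\<bar>"
  define u where "u j = 1 / (1 - \<bar>T j\<bar>)" for j
  have "u (N + k) = u N - real k" for k
  proof (induction k)
    case (Suc k)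
    have "1/2 < \<bar>T (N + k)\<bar>" using near by simp
    from inverse_dist_fixed_point_even_map[OF this abs_T_less]
    have "u (N + Suc k) = u (N + k) - 1" by (simp add: u_def)
    then show ?case using Suc by simp
  qed simp
  moreover have "u j > 0" for j using abs_T_less[of j] by (simp add: u_def)
  ultimately have "real k < u N" for k by (metis diff_gt_0_iff_gt)
  then show False by (meson reals_Archimedean2 less_asym)
qed

text \<open>The absolute values decrease to some \<open>L\<close>. If \<open>L\<close> were nonzero,
  the ratios \<open>\<bar>T j\<bar>\<close> of consecutive terms would tend to 1, and the orbit
  would stay near the neutral fixed points.\<close>

lemma s_tendsto_0: "s \<longlonglongrightarrow> 0"
proof -
  have dec: "decseq (\<lambda>j. \<bar>s j\<bar>)"
    using abs_s_Suc_less by (intro decseq_SucI) (simp add: less_imp_le)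
  obtain L where L: "(\<lambda>j. \<bar>s j\<bar>) \<longlonglongrightarrow> L" "\<And>j. L \<le> \<bar>s j\<bar>"
    using decseq_convergent[OF dec, of 0] by auto
  have "L \<ge> 0" by (rule LIMSEQ_le_const[OF L(1)]) auto
  moreover have "L = 0"
  proof (rule ccontr)
    assume "L \<noteq> 0"
    have "(\<lambda>j. \<bar>s (Suc j)\<bar> / \<bar>s j\<bar>) \<longlonglongrightarrow> L / L"
      using \<open>L \<noteq> 0\<close> by (intro tendsto_divide L LIMSEQ_Suc[OF L(1)])
    then have "(\<lambda>j. \<bar>T j\<bar>) \<longlonglongrightarrow> 1"
      using \<open>L \<noteq> 0\<close> by (simp add: orbit_prod_Suc abs_mult)
    then have "eventually (\<lambda>j. 1/2 < \<bar>T j\<bar>) sequentially"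
      by (rule order_tendstoD(1)) simp
    then show False
      using not_eventually_near_fixed_point unfolding eventually_sequentially by blast
  qed
  ultimately show ?thesis using L(1) by (simp add: tendsto_rabs_zero_iff)
qed

section \<open>Bounded variation and summation by parts\<close>

lemma orbit_powr_tendsto_0:
  assumes "\<alpha> > 0"
  shows "(\<lambda>j. \<bar>s j\<bar> powr \<alpha>) \<longlonglongrightarrow> 0"
  using assms s_tendsto_0 
  by (intro tendsto_zero_powrI[where b=\<alpha>]) (auto simp: tendsto_rabs_zero_iff)

lemma orbit_powr_diff_summable:
  assumes "\<alpha> > 0"
  shows "summable (\<lambda>j. \<bar>s j\<bar> powr \<alpha> - \<bar>s (Suc j)\<bar> powr \<alpha>)"
  by (rule telescope_summable'[OF orbit_powr_tendsto_0[OF assms]])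

lemma orbit_powr_Suc: "\<bar>s (Suc j)\<bar> powr \<alpha> = \<bar>s j\<bar> powr \<alpha> * \<bar>T j\<bar> powr \<alpha>"
  by (simp add: orbit_prod_Suc abs_mult powr_mult)

lemma orbit_powr_Suc_le: "\<alpha> > 0 \<Longrightarrow> \<bar>s (Suc j)\<bar> powr \<alpha> \<le> \<bar>s j\<bar> powr \<alpha>"
  using abs_s_Suc_less[of j] by (intro powr_mono2) auto

text \<open>The right-hand side telescopes, so errors proportional to the distance of
  \<open>T j\<close> from its nearer endpoint become summable.\<close>

lemma orbit_powr_defect_le:
  assumes "\<alpha> > 0"
  shows "\<bar>s j\<bar> powr \<alpha> * (1 - \<bar>T j\<bar>) \<le> (\<bar>s j\<bar> powr \<alpha> - \<bar>s (Suc j)\<bar> powr \<alpha>) / min 1 \<alpha>"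
proof -
  have "min 1 \<alpha> * (1 - \<bar>T j\<bar>) \<le> 1 - \<bar>T j\<bar> powr \<alpha>"
    using assms abs_T_less[of j] by (intro one_minus_powr_ge) (auto simp: less_imp_le)
  then have "\<bar>s j\<bar> powr \<alpha> * (min 1 \<alpha> * (1 - \<bar>T j\<bar>)) \<le> \<bar>s j\<bar> powr \<alpha> * (1 - \<bar>T j\<bar> powr \<alpha>)"
    by (rule mult_left_mono) simp
  moreover have "min 1 \<alpha> > 0" using assms by simp
  ultimately show ?thesis
    by (subst pos_le_divide_eq) (simp_all add: orbit_powr_Suc algebra_simps)
qed

text \<open>The oscillating core of the argument, by summation by parts. Later \<open>w\<close> is
  \<Omega>, evaluated only at 1 and -1.\<close>

lemma summable_orbit_sgn:
  fixes w :: "real \<Rightarrow> complex"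
  assumes "\<alpha> > 0"
  shows "summable (\<lambda>j. orbit_phase x j * of_real (\<bar>s j\<bar> powr \<alpha>) * w (sgn (T j)))"
proof -
  \<comment> \<open>Dividing by \<open>cis (pi / 4 * t) - 1\<close> turns the phase into a
    difference of consecutive phases, so that the term of the series is
    \<open>(orbit_phase x (Suc j) - orbit_phase x j) * G j\<close>.\<close>
  define W where "W t = w t / (cis (pi / 4 * t) - 1)" for t
  define P where "P j = \<bar>s j\<bar> powr \<alpha>" for j
  define G where "G j = of_real (P j) * W (sgn (T j))" for j
  define M where "M = norm (W 1) + norm (W (-1))"
  define r where "r = (1/2) powr \<alpha>"
  have "M \<ge> 0" by (simp add: M_def)
  have "r < (1/2) powr 0"
    unfolding r_def using assms by (intro powr_less_mono') auto
  then have r: "0 < r" "r < 1" by (simp_all add: r_def)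
  have sgn_T: "sgn (T j) = 1 \<or> sgn (T j) = -1" for j
    by (auto simp: sgn_if)
  have W: "norm (W (sgn (T j))) \<le> M" for j
    using sgn_T[of j] by (auto simp: M_def)
  have P: "P j \<ge> 0" "P (Suc j) \<le> P j" for j
    using assms orbit_powr_Suc_le by (auto simp: P_def)
  have norm_G: "norm (G j) \<le> M * P j" for j
    using mult_right_mono[OF W P(1)] P(1)[of j] by (simp add: G_def norm_mult mult.commute)
  have "G \<longlonglongrightarrow> 0"
  proof (rule Lim_null_comparison)
    show "(\<lambda>j. M * P j) \<longlonglongrightarrow> 0"
      unfolding P_def using orbit_powr_tendsto_0[OF assms] by (rule tendsto_mult_right_zero)
  qed (simp add: norm_G)
  then have "(\<lambda>j. orbit_phase x j * G j) \<longlonglongrightarrow> 0"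
    by (subst tendsto_norm_zero_iff [symmetric]) (simp add: norm_mult tendsto_norm_zero)
  then have tele: "summable (\<lambda>j. orbit_phase x (Suc j) * G (Suc j) - orbit_phase x j * G j)"
    by (rule telescope_summable)
  \<comment> \<open>If the sign persists, only \<open>P\<close> changes. A sign change forces
    \<open>\<bar>T j\<bar> \<le> 1/2\<close>, hence \<open>P (Suc j) \<le> r * P j\<close>, and
    \<open>P j\<close> itself is at most its decrement over \<open>1 - r\<close>.\<close>
  have var: "norm (G (Suc j) - G j) \<le> (2 * M / (1 - r)) * (P j - P (Suc j))" for j
  proof (cases "sgn (T (Suc j)) = sgn (T j)")
    case True
    then have "G (Suc j) - G j = of_real (P (Suc j) - P j) * W (sgn (T j))"
      by (simp add: G_def algebra_simps)
    then have "norm (G (Suc j) - G j) = (P j - P (Suc j)) * norm (W (sgn (T j)))"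
      using P(2)[of j] by (simp add: norm_mult del: of_real_diff)
    also have "\<dots> \<le> (P j - P (Suc j)) * (2 * M / (1 - r))"
    proof (rule mult_left_mono)
      have "M * (1 - r) \<le> M * 2" using \<open>M \<ge> 0\<close> r by (intro mult_left_mono) auto
      then have "M \<le> 2 * M / (1 - r)" using r by (simp add: pos_le_divide_eq mult.commute)
      then show "norm (W (sgn (T j))) \<le> 2 * M / (1 - r)" using W[of j] by simp
    qed (use P(2)[of j] in simp)
    finally show ?thesis by (simp add: mult.commute)
  next
    case False
    then have "\<bar>T j\<bar> \<le> 1/2"
      using sgn_even_map[of "T j"] by force
    then have "\<bar>T j\<bar> powr \<alpha> \<le> r"
      unfolding r_def using assms by (intro powr_mono2) auto
    then have "P (Suc j) \<le> P j * r"
      unfolding P_def orbit_powr_Suc by (intro mult_left_mono) auto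
    then have "P j \<le> (P j - P (Suc j)) / (1 - r)"
      using r by (simp add: pos_le_divide_eq algebra_simps)
    then have "2 * M * P j \<le> 2 * M * ((P j - P (Suc j)) / (1 - r))"
      using \<open>M \<ge> 0\<close> by (intro mult_left_mono) auto
    moreover have "norm (G (Suc j) - G j) \<le> M * P (Suc j) + M * P j"
      using norm_triangle_ineq4[of "G (Suc j)" "G j"] norm_G[of j] norm_G[of "Suc j"] by linarith
    moreover have "M * P (Suc j) \<le> M * P j"
      using P(2) \<open>M \<ge> 0\<close> by (rule mult_left_mono)
    ultimately show ?thesis by simp
  qed
  \<comment> \<open>Absolutely convergent by \<open>var\<close>. Subtracting it from the telescoping
    series leaves the phase differences times \<open>G j\<close>.\<close>
  have "summable (\<lambda>j. orbit_phase x (Suc j) * (G (Suc j) - G j))"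
  proof (rule summable_comparison_test'[where N=0])
    show "summable (\<lambda>j. (2 * M / (1 - r)) * (P j - P (Suc j)))"
      unfolding P_def by (intro summable_mult orbit_powr_diff_summable assms)
  qed (use var in \<open>simp add: norm_mult\<close>)
  from summable_diff[OF tele this]
  have "summable (\<lambda>j. (orbit_phase x (Suc j) - orbit_phase x j) * G j)"
    by (simp add: algebra_simps)
  moreover have "(orbit_phase x (Suc j) - orbit_phase x j) * G j =
      orbit_phase x j * of_real (P j) * w (sgn (T j))" for j
  proof -
    have "cis (pi / 4 * sgn (T j)) \<noteq> 1"
    proof
      assume "cis (pi / 4 * sgn (T j)) = 1"
      then have "cos (pi / 4 * sgn (T j)) = 1" by (metis cis.sel(1) one_complex.sel(1))
      then have "sqrt 2 = 2" using sgn_T[of j] by (auto simp: cos_45)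
      then show False using sqrt2_less_2 by simp
    qed
    then show ?thesis by (simp add: G_def W_def orbit_phase_Suc field_simps)
  qed
  ultimately show ?thesis by (simp add: P_def)
qed

lemma summable_orbit_bounded:
  fixes \<Omega> :: "real \<Rightarrow> complex"
  assumes "bounded (\<Omega> ` {-1..1})"
    and "\<Omega> differentiable (at 1 within {-1..1})" "\<Omega> differentiable (at (-1) within {-1..1})"
    and "\<alpha> > 0"
  shows "summable (\<lambda>j. orbit_phase x j * of_real (\<bar>s j\<bar> powr \<alpha>) * \<Omega> (T j))"
proof -
  obtain K1 where K1: "K1 \<ge> 0" "\<And>y. y \<in> {-1..1} \<Longrightarrow> norm (\<Omega> y - \<Omega> 1) \<le> K1 * \<bar>y - 1\<bar>"
    using differentiable_bounded_imp_lipschitz_at[OF assms(1,2)] by auto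
  obtain K2 where K2: "K2 \<ge> 0" "\<And>y. y \<in> {-1..1} \<Longrightarrow> norm (\<Omega> y - \<Omega> (-1)) \<le> K2 * \<bar>y - (-1)\<bar>"
    using differentiable_bounded_imp_lipschitz_at[OF assms(1,3)] by auto
  \<comment> \<open>The nearer endpoint is \<open>sgn (T j)\<close>, at distance
    \<open>1 - \<bar>T j\<bar>\<close>; \<open>K1\<close> serves the endpoint 1 and
    \<open>K2\<close> the endpoint -1.\<close>
  have dev: "norm (\<Omega> (T j) - \<Omega> (sgn (T j))) \<le> (K1 + K2) * (1 - \<bar>T j\<bar>)" for j
  proof (cases "T j > 0")
    case True
    then have "norm (\<Omega> (T j) - \<Omega> (sgn (T j))) \<le> K1 * (1 - \<bar>T j\<bar>)"
      using K1(2)[of "T j"] abs_T_less[of j] by (simp add: abs_if)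
    also have "\<dots> \<le> (K1 + K2) * (1 - \<bar>T j\<bar>)"
      using K2(1) by (intro mult_right_mono) (simp_all add: less_imp_le)
    finally show ?thesis .
  next
    case False
    then have neg: "T j < 0" using T_nonzero[of j] by linarith
    then have "norm (\<Omega> (T j) - \<Omega> (sgn (T j))) \<le> K2 * (1 - \<bar>T j\<bar>)"
      using K2(2)[of "T j"] abs_T_less[of j] by (simp add: abs_if add.commute split: if_splits)
    also have "\<dots> \<le> (K1 + K2) * (1 - \<bar>T j\<bar>)"
      using K1(1) by (intro mult_right_mono) (simp_all add: less_imp_le)
    finally show ?thesis .
  qed
  have "summable (\<lambda>j. orbit_phase x j * of_real (\<bar>s j\<bar> powr \<alpha>) * (\<Omega> (T j) - \<Omega> (sgn (T j))))"
  proof (rule summable_comparison_test'[where N=0])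
    show "summable (\<lambda>j. (K1 + K2) / min 1 \<alpha> * (\<bar>s j\<bar> powr \<alpha> - \<bar>s (Suc j)\<bar> powr \<alpha>))"
      by (intro summable_mult orbit_powr_diff_summable assms)
    fix j
    have "norm (orbit_phase x j * of_real (\<bar>s j\<bar> powr \<alpha>) * (\<Omega> (T j) - \<Omega> (sgn (T j)))) =
        \<bar>s j\<bar> powr \<alpha> * norm (\<Omega> (T j) - \<Omega> (sgn (T j)))"
      by (simp add: norm_mult)
    also have "\<dots> \<le> \<bar>s j\<bar> powr \<alpha> * ((K1 + K2) * (1 - \<bar>T j\<bar>))"
      by (intro mult_left_mono dev) simp
    also have "\<dots> = (K1 + K2) * (\<bar>s j\<bar> powr \<alpha> * (1 - \<bar>T j\<bar>))" by simp
    also have "\<dots> \<le> (K1 + K2) * ((\<bar>s j\<bar> powr \<alpha> - \<bar>s (Suc j)\<bar> powr \<alpha>) / min 1 \<alpha>)"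
      using K1(1) K2(1) assms(4) by (intro mult_left_mono orbit_powr_defect_le) auto
    finally show "norm (orbit_phase x j * of_real (\<bar>s j\<bar> powr \<alpha>) * (\<Omega> (T j) - \<Omega> (sgn (T j)))) \<le>
        (K1 + K2) / min 1 \<alpha> * (\<bar>s j\<bar> powr \<alpha> - \<bar>s (Suc j)\<bar> powr \<alpha>)" by simp
  qed
  from summable_add[OF this summable_orbit_sgn[OF assms(4), of \<Omega>]]
  show ?thesis by (simp add: algebra_simps)
qed

section \<open>Regular convergents and best approximation\<close>

abbreviation Q :: "nat \<Rightarrow> int" where "Q n \<equiv> rcf_denom x n"

definition \<delta> :: "nat \<Rightarrow> real" where
  "\<delta> n = of_int (Q n) * x - of_int (rcf_numer x n)"

lemma rcf_complete_irrational: "rcf_complete x n \<notin> \<rat>"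
proof (induction n)
  case (Suc n)
  have "frac (rcf_complete x n) \<notin> \<rat>"
  proof
    assume "frac (rcf_complete x n) \<in> \<rat>"
    then have "frac (rcf_complete x n) + of_int \<lfloor>rcf_complete x n\<rfloor> \<in> \<rat>" by (rule Rats_add) simp
    then show False using Suc by (simp add: frac_def)
  qed
  then show ?case
    using Rats_divide[OF Rats_1, of "1 / frac (rcf_complete x n)"] by auto
qed (simp add: irrational)

lemma frac_rcf_complete: "0 < frac (rcf_complete x n)" "frac (rcf_complete x n) < 1"
proof -
  have "rcf_complete x n \<notin> \<int>"
    using rcf_complete_irrational Ints_subset_Rats by blast
  then show "0 < frac (rcf_complete x n)" by (simp add: frac_gt_0_iff)
qed (rule frac_lt_1)

lemma rcf_partial_Suc_ge_1: "rcf_partial x (Suc n) \<ge> 1"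
  using frac_rcf_complete[of n] by (simp add: rcf_partial_def le_floor_iff)

lemma Q_pos_mono: "1 \<le> Q n \<and> Q n \<le> Q (Suc n)"
proof (induction n)
  case 0
  then show ?case using rcf_partial_Suc_ge_1[of 0] by simp
next
  case (Suc n)
  have "1 * Q (Suc n) \<le> rcf_partial x (Suc (Suc n)) * Q (Suc n)"
    using Suc rcf_partial_Suc_ge_1[of "Suc n"] by (intro mult_right_mono) auto
  then show ?case using Suc by (simp only: rcf_denom.simps) linarith
qed

lemma Q_ge_1: "1 \<le> Q n" and Q_le_Suc: "Q n \<le> Q (Suc n)"
  using Q_pos_mono by auto

lemma Q_add_le: "Q (Suc n) + Q n \<le> Q (Suc (Suc n))"
proof -
  have "1 * Q (Suc n) \<le> rcf_partial x (Suc (Suc n)) * Q (Suc n)"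
    using Q_ge_1[of "Suc n"] rcf_partial_Suc_ge_1[of "Suc n"] by (intro mult_right_mono) auto
  then show ?thesis by simp
qed

text \<open>Linear growth suffices: it makes the index \<open>\<nu> j\<close> exist and keeps the
  logarithms of \<open>Q (Suc (Suc n))\<close> at least \<open>ln 2\<close>.\<close>

lemma Q_Suc_ge: "int n < Q (Suc n)"
proof (induction n)
  case (Suc n)
  then show ?case using Q_add_le[of n] Q_ge_1[of n] by (simp del: rcf_denom.simps)
qed (use Q_ge_1[of 1] in simp)

text \<open>The convergent recurrence passes to \<delta>. Writing \<open>\<delta> n\<close> through
  the next complete quotient leaves partial minus complete quotient, which is minus a fractional
  part. In particular \<delta> alternates in sign.\<close>

lemma \<delta>_Suc: "\<delta> (Suc n) = - \<delta> n * frac (rcf_complete x (Suc n))"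
proof (induction n)
  case 0
  have "frac x = x" using x_pos x_less by (simp add: frac_eq)
  then show ?case
    using x_pos by (simp add: \<delta>_def rcf_partial_def frac_def algebra_simps)
next
  case (Suc n)
  have "\<delta> n = - \<delta> (Suc n) * rcf_complete x (Suc (Suc n))"
    using Suc frac_rcf_complete[of "Suc n"] by (simp add: field_simps)
  moreover have "\<delta> (Suc (Suc n)) = of_int (rcf_partial x (Suc (Suc n))) * \<delta> (Suc n) + \<delta> n"
    by (simp add: \<delta>_def algebra_simps)
  ultimately show ?case
    by (simp only: frac_def rcf_partial_def) (simp add: algebra_simps)
qed

lemma \<delta>_nonzero: "\<delta> n \<noteq> 0"
proof (induction n)
  case (Suc n)
  then show ?case using frac_rcf_complete(1)[of "Suc n"] by (simp add: \<delta>_Suc del: rcf_complete.simps)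
qed (use x_pos in \<open>simp add: \<delta>_def\<close>)

lemma abs_\<delta>_Suc_less: "\<bar>\<delta> (Suc n)\<bar> < \<bar>\<delta> n\<bar>"
  using frac_rcf_complete[of "Suc n"] \<delta>_nonzero[of n]
  by (simp add: \<delta>_Suc abs_mult mult_less_cancel_left1 del: rcf_complete.simps)

lemma rcf_det: "Q n * rcf_numer x (Suc n) - Q (Suc n) * rcf_numer x n = (-1) ^ n"
proof (induction n)
  case (Suc n)
  then show ?case by (simp add: algebra_simps)
qed simp

text \<open>Rewritten through \<delta>, the determinant identity splits 1 into two terms, each at
  most \<open>Q (Suc n) * \<bar>\<delta> n\<bar>\<close> in absolute value.\<close>

lemma abs_\<delta>_ge: "1 / (2 * of_int (Q (Suc n))) \<le> \<bar>\<delta> n\<bar>"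
proof -
  have "of_int (Q (Suc n)) * \<delta> n - of_int (Q n) * \<delta> (Suc n) = (-1) ^ n"
    using arg_cong[OF rcf_det[of n], of real_of_int] by (simp add: \<delta>_def algebra_simps del: rcf_denom.simps rcf_numer.simps)
  then have "1 = \<bar>of_int (Q (Suc n)) * \<delta> n - of_int (Q n) * \<delta> (Suc n)\<bar>"
    by simp
  also have "\<dots> \<le> of_int (Q (Suc n)) * \<bar>\<delta> n\<bar> + of_int (Q n) * \<bar>\<delta> (Suc n)\<bar>"
    using Q_ge_1[of n] Q_ge_1[of "Suc n"] abs_triangle_ineq4 [of "of_int (Q (Suc n)) * \<delta> n" "of_int (Q n) * \<delta> (Suc n)"]
    by (simp add: abs_mult)
  also have "of_int (Q n) * \<bar>\<delta> (Suc n)\<bar> \<le> of_int (Q (Suc n)) * \<bar>\<delta> n\<bar>"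
    using Q_ge_1[of n] Q_le_Suc[of n] abs_\<delta>_Suc_less[of n] by (intro mult_mono) auto
  finally show ?thesis
    using Q_ge_1[of "Suc n"] by (simp add: field_simps)
qed

text \<open>Lagrange's argument: expand \<open>(a, b)\<close> in the unimodular basis of two
  consecutive convergents. The bound on \<open>a\<close> makes the coefficient \<open>c\<close>
  nonzero and forbids \<open>c\<close> and \<open>d\<close> to share a sign; as \<delta> alternates,
  the two contributions then cannot cancel.\<close>

lemma best_approximation:
  fixes a b :: int
  assumes "a \<noteq> 0" "\<bar>a\<bar> < Q (Suc n)"
  shows "\<bar>\<delta> n\<bar> \<le> \<bar>of_int a * x - of_int b\<bar>"
proof -
  let ?P = "rcf_numer x"
  define e :: int where "e = (-1) ^ n"
  \<comment> \<open>Cramer's rule; the determinant \<open>e\<close> is 1 or -1 and hence its own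
    inverse.\<close>
  define c where "c = e * (a * ?P (Suc n) - b * Q (Suc n))"
  define d where "d = e * (b * Q n - a * ?P n)"
  have e: "e * e = 1" by (simp add: e_def flip: power_mult_distrib)
  have det: "Q n * ?P (Suc n) - Q (Suc n) * ?P n = e" by (simp only: rcf_det e_def)
  have "c * Q n + d * Q (Suc n) = e * (Q n * ?P (Suc n) - Q (Suc n) * ?P n) * a"
    unfolding c_def d_def by (simp add: algebra_simps del: rcf_denom.simps rcf_numer.simps)
  then have a: "a = c * Q n + d * Q (Suc n)" by (simp only: det e)
  have "c * ?P n + d * ?P (Suc n) = e * (Q n * ?P (Suc n) - Q (Suc n) * ?P n) * b"
    unfolding c_def d_def by (simp add: algebra_simps del: rcf_denom.simps rcf_numer.simps)
  then have b: "b = c * ?P n + d * ?P (Suc n)" by (simp only: det e)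
  have eq: "of_int a * x - of_int b = of_int c * \<delta> n + of_int d * \<delta> (Suc n)"
    unfolding \<delta>_def by (subst a, subst b) (simp add: algebra_simps del: rcf_denom.simps rcf_numer.simps)
  have c: "c \<noteq> 0"
  proof
    assume "c = 0"
    then have "\<bar>a\<bar> = \<bar>d\<bar> * Q (Suc n)" using a Q_ge_1[of "Suc n"] by (simp add: abs_mult)
    moreover have "\<bar>d\<bar> \<ge> 1" using \<open>a \<noteq> 0\<close> a \<open>c = 0\<close> by auto
    ultimately have "\<bar>a\<bar> \<ge> 1 * Q (Suc n)" using Q_ge_1[of "Suc n"] by (metis mult_right_mono order_trans zero_le_one)
    then show False using assms by simp
  qed
  \<comment> \<open>With equal signs nothing cancels in \<open>a = c * Q n + d * Q (Suc n)\<close>,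
    so \<open>\<bar>a\<bar>\<close> would reach \<open>Q (Suc n)\<close>.\<close>
  have cd: "c * d \<le> 0"
  proof (rule ccontr)
    assume "\<not> c * d \<le> 0"
    then have cd: "(c > 0 \<and> d > 0) \<or> (c < 0 \<and> d < 0)" by (simp add: not_le zero_less_mult_iff)
    have "\<bar>a\<bar> = \<bar>c\<bar> * Q n + \<bar>d\<bar> * Q (Suc n)"
      using cd
    proof
      assume "c > 0 \<and> d > 0"
      then show ?thesis using Q_ge_1[of "Suc n"] Q_ge_1[of n] unfolding a by (simp add: abs_of_nonneg del: rcf_denom.simps)
    next
      assume "c < 0 \<and> d < 0"
      then have "c * Q n + d * Q (Suc n) < 0"
        using Q_ge_1[of "Suc n"] Q_ge_1[of n] by (intro add_neg_neg mult_neg_pos) auto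
      then show ?thesis using \<open>c < 0 \<and> d < 0\<close> unfolding a by (simp add: abs_of_neg del: rcf_denom.simps)
    qed
    moreover have "\<bar>d\<bar> * Q (Suc n) \<ge> 1 * Q (Suc n)" using cd Q_ge_1[of "Suc n"] by (intro mult_right_mono) auto
    moreover have "\<bar>c\<bar> * Q n \<ge> 0" using Q_ge_1[of n] by simp
    ultimately show False using assms by linarith
  qed
  have "(of_int c * \<delta> n) * (of_int d * \<delta> (Suc n)) = - of_int (c * d) * (\<delta> n * \<delta> n) * frac (rcf_complete x (Suc n))"
    by (simp add: \<delta>_Suc algebra_simps del: rcf_complete.simps)
  also have "\<dots> \<ge> 0"
    using cd frac_rcf_complete(1)[of "Suc n"]
    by (intro mult_nonneg_nonneg zero_le_square)
      (simp_all add: less_imp_le del: rcf_complete.simps of_int_mult)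
  finally have "\<bar>of_int c * \<delta> n + of_int d * \<delta> (Suc n)\<bar> \<ge> \<bar>of_int c * \<delta> n\<bar>"
    by (auto simp: zero_le_mult_iff)
  moreover have "\<bar>of_int c * \<delta> n\<bar> \<ge> 1 * \<bar>\<delta> n\<bar>"
    unfolding abs_mult using c by (intro mult_right_mono) auto
  ultimately show ?thesis unfolding eq by linarith
qed

text \<open>Numerators and denominators of the continued fraction of \<open>x\<close> with even partial quotients,
  normalised by \<open>s j = q j * x - p j\<close>.\<close>

definition even_quot :: "nat \<Rightarrow> int" where
  "even_quot j = 2 * \<lceil>(- 1 / T j - 1) / 2\<rceil>"

fun q :: "nat \<Rightarrow> int" where
  "q 0 = 0" | "q (Suc 0) = 1" | "q (Suc (Suc j)) = - even_quot j * q (Suc j) - q j"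

fun p :: "nat \<Rightarrow> int" where
  "p 0 = -1" | "p (Suc 0) = 0" | "p (Suc (Suc j)) = - even_quot j * p (Suc j) - p j"

lemma T_Suc: "T (Suc j) = - 1 / T j - of_int (even_quot j)"
  by (simp add: even_map_def even_quot_def)

lemma s_eq: "s j = of_int (q j) * x - of_int (p j)"
proof (induction j rule: q.induct)
  case (3 j)
  have "s (Suc (Suc j)) = s (Suc j) * (- 1 / T j - of_int (even_quot j))"
    by (subst orbit_prod_Suc) (simp only: T_Suc)
  also have "\<dots> = - of_int (even_quot j) * s (Suc j) - s j"
    by (simp add: orbit_prod_Suc field_simps)
  finally show ?case using 3 by (simp add: algebra_simps)
qed (simp_all add: orbit_prod_Suc)

text \<open>A zero quotient would invert \<open>T j\<close> and leave the interval; evenness then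
  excludes 1 and -1.\<close>

lemma abs_even_quot_ge: "\<bar>even_quot j\<bar> \<ge> 2"
proof -
  have "even_quot j \<noteq> 0"
  proof
    assume "even_quot j = 0"
    then have "\<bar>T (Suc j)\<bar> = 1 / \<bar>T j\<bar>" by (simp add: T_Suc del: funpow.simps)
    moreover have "1 / \<bar>T j\<bar> > 1" by simp
    ultimately show False using abs_T_less[of "Suc j"] by linarith
  qed
  then show ?thesis by (auto simp: even_quot_def)
qed

lemma abs_q_mono_aux: "\<bar>q j\<bar> \<le> \<bar>q (Suc j)\<bar> \<and> 1 \<le> \<bar>q (Suc j)\<bar>"
proof (induction j)
  case (Suc j)
  have "2 * \<bar>q (Suc j)\<bar> \<le> \<bar>even_quot j\<bar> * \<bar>q (Suc j)\<bar>"
    using abs_even_quot_ge by (intro mult_right_mono) auto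
  also have "\<dots> = \<bar>even_quot j * q (Suc j)\<bar>" by (simp add: abs_mult)
  finally have "\<bar>q (Suc j)\<bar> \<le> \<bar>- even_quot j * q (Suc j) - q j\<bar>" using Suc by linarith
  then show ?case using Suc unfolding q.simps by linarith
qed simp

lemma abs_q_le_Suc: "\<bar>q j\<bar> \<le> \<bar>q (Suc j)\<bar>" and abs_q_Suc_ge_1: "1 \<le> \<bar>q (Suc j)\<bar>"
  using abs_q_mono_aux by auto

lemma abs_q_mono: "i \<le> j \<Longrightarrow> \<bar>q i\<bar> \<le> \<bar>q j\<bar>"
  by (induction rule: dec_induct) (use abs_q_le_Suc order_trans in blast)+

lemma even_det: "q (Suc j) * p j - q j * p (Suc j) = -1"
  by (induction j) (auto simp: algebra_simps)

text \<open>After substituting \<open>s_eq\<close> the terms in \<open>x\<close> cancel and only the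
  determinant remains.\<close>

lemma s_mult_q: "s j * (of_int (q (Suc j)) - of_int (q j) * T j) = 1"
proof -
  have "s j * (of_int (q (Suc j)) - of_int (q j) * T j) = of_int (q (Suc j)) * s j - of_int (q j) * s (Suc j)"
    by (simp add: orbit_prod_Suc algebra_simps)
  also have "\<dots> = - of_int (q (Suc j) * p j - q j * p (Suc j))"
    by (simp add: s_eq algebra_simps)
  finally show ?thesis by (simp only: even_det)
qed

text \<open>Since \<open>\<bar>q j\<bar> \<le> \<bar>q (Suc j)\<bar>\<close>, the second factor in
  \<open>s_mult_q\<close> keeps at least 3/4 of \<open>\<bar>q (Suc j)\<bar>\<close>.\<close>

lemma abs_s_mult_q_le:
  assumes "\<bar>T j\<bar> < 1/4"
  shows "\<bar>s j\<bar> * of_int \<bar>q (Suc j)\<bar> \<le> 4/3"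
proof -
  have "\<bar>of_int (q j) * T j\<bar> \<le> of_int \<bar>q (Suc j)\<bar> * (1/4)"
    unfolding abs_mult using assms abs_q_le_Suc[of j] by (intro mult_mono) auto
  then have "of_int \<bar>q (Suc j)\<bar> * (3/4) \<le> \<bar>of_int (q (Suc j)) - of_int (q j) * T j\<bar>"
    by linarith
  then have "\<bar>s j\<bar> * (of_int \<bar>q (Suc j)\<bar> * (3/4)) \<le> \<bar>s j\<bar> * \<bar>of_int (q (Suc j)) - of_int (q j) * T j\<bar>"
    by (rule mult_left_mono) simp
  also have "\<dots> = 1" using s_mult_q[of j] by (simp flip: abs_mult)
  finally show ?thesis by simp
qed

section \<open>Matching even convergents with regular ones\<close>

definition \<nu> :: "nat \<Rightarrow> nat" where
  "\<nu> j = (LEAST n. \<bar>q (Suc j)\<bar> < Q (Suc n))"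

lemma \<nu>_upper: "\<bar>q (Suc j)\<bar> < Q (Suc (\<nu> j))"
  unfolding \<nu>_def using Q_Suc_ge[of "nat \<bar>q (Suc j)\<bar>"] by (intro LeastI) simp

lemma \<nu>_lower: "Q (\<nu> j) \<le> \<bar>q (Suc j)\<bar>"
proof (cases "\<nu> j")
  case 0
  then show ?thesis using abs_q_Suc_ge_1 by simp
next
  case (Suc n)
  then have "\<not> \<bar>q (Suc j)\<bar> < Q (Suc n)" unfolding \<nu>_def using not_less_Least[of n "\<lambda>n. \<bar>q (Suc j)\<bar> < Q (Suc n)"] by (metis lessI)
  then show ?thesis using Suc by simp
qed

lemma abs_s_le:
  assumes "\<bar>T j\<bar> < 1/4"
  shows "\<bar>s j\<bar> \<le> 4/3 / of_int (Q (\<nu> j))"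
proof -
  have "\<bar>s j\<bar> * of_int (Q (\<nu> j)) \<le> \<bar>s j\<bar> * of_int \<bar>q (Suc j)\<bar>"
    using \<nu>_lower by (intro mult_left_mono) (simp_all only: of_int_le_iff abs_ge_zero)
  also have "\<dots> \<le> 4/3" using abs_s_mult_q_le[OF assms] .
  finally show ?thesis using Q_ge_1[of "\<nu> j"] by (simp add: pos_le_divide_eq)
qed

lemma abs_\<delta>_le_s: "\<bar>\<delta> (\<nu> j)\<bar> \<le> \<bar>s (Suc j)\<bar>"
  unfolding s_eq using abs_q_Suc_ge_1[of j] \<nu>_upper[of j] by (intro best_approximation) auto

lemma abs_s_Suc_ge: "1 / (2 * of_int (Q (Suc (\<nu> j)))) \<le> \<bar>s (Suc j)\<bar>"
  using abs_\<delta>_ge abs_\<delta>_le_s by (rule order_trans)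

text \<open>Legendre's criterion: an integer determinant of absolute value below \<open>1\<close> vanishes.\<close>

lemma convergent_parallel:
  assumes "\<bar>T j\<bar> < 1/4"
  shows "of_int \<bar>q (Suc j)\<bar> * \<bar>\<delta> (\<nu> j)\<bar> = of_int (Q (\<nu> j)) * \<bar>s (Suc j)\<bar>"
proof -
  define D where "D = Q (\<nu> j) * p (Suc j) - q (Suc j) * rcf_numer x (\<nu> j)"
  have D: "of_int D = of_int (q (Suc j)) * \<delta> (\<nu> j) - of_int (Q (\<nu> j)) * s (Suc j)"
    by (simp add: D_def \<delta>_def s_eq algebra_simps)
  have small: "of_int \<bar>q (Suc j)\<bar> * \<bar>s (Suc j)\<bar> < 1/2"
  proof -
    have "of_int \<bar>q (Suc j)\<bar> * \<bar>s (Suc j)\<bar> = (\<bar>s j\<bar> * of_int \<bar>q (Suc j)\<bar>) * \<bar>T j\<bar>"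
      by (simp add: orbit_prod_Suc abs_mult)
    also have "\<dots> \<le> 4/3 * (1/4)"
      using assms abs_s_mult_q_le[OF assms] by (intro mult_mono) auto
    finally show ?thesis by simp
  qed
  \<comment> \<open>Both terms are at most
    \<open>\<bar>q (Suc j)\<bar> * \<bar>s (Suc j)\<bar>\<close>, which the cutoff 1/4 keeps below
    1/2.\<close>
  have "\<bar>of_int D\<bar> \<le> of_int \<bar>q (Suc j)\<bar> * \<bar>\<delta> (\<nu> j)\<bar> + of_int (Q (\<nu> j)) * \<bar>s (Suc j)\<bar>"
    unfolding D using abs_triangle_ineq4[of "of_int (q (Suc j)) * \<delta> (\<nu> j)" "of_int (Q (\<nu> j)) * s (Suc j)"]
      Q_ge_1[of "\<nu> j"] by (simp add: abs_mult)
  also have "of_int \<bar>q (Suc j)\<bar> * \<bar>\<delta> (\<nu> j)\<bar> \<le> of_int \<bar>q (Suc j)\<bar> * \<bar>s (Suc j)\<bar>"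
    using abs_\<delta>_le_s by (intro mult_left_mono) auto
  also have "of_int (Q (\<nu> j)) * \<bar>s (Suc j)\<bar> \<le> of_int \<bar>q (Suc j)\<bar> * \<bar>s (Suc j)\<bar>"
    using \<nu>_lower by (intro mult_right_mono) (simp_all only: of_int_le_iff abs_ge_zero)
  finally have "\<bar>real_of_int D\<bar> < 1" using small by linarith
  then have "D = 0" by linarith
  then have "of_int (q (Suc j)) * \<delta> (\<nu> j) = of_int (Q (\<nu> j)) * s (Suc j)" using D by simp
  then have "\<bar>of_int (q (Suc j)) * \<delta> (\<nu> j)\<bar> = \<bar>of_int (Q (\<nu> j)) * s (Suc j)\<bar>" by simp
  then show ?thesis using Q_ge_1[of "\<nu> j"] by (simp add: abs_mult)
qed

text \<open>If \<open>i < j\<close> shared an index, \<open>convergent_parallel\<close> would make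
  \<open>\<bar>q\<bar>\<close> proportional to \<open>\<bar>s\<bar>\<close> at these two places, but
  \<open>\<bar>s\<bar>\<close> strictly decreases while \<open>\<bar>q\<bar>\<close> does
  not.\<close>

lemma inj_on_\<nu>: "inj_on \<nu> {j. \<bar>T j\<bar> < 1/4}"
proof (rule linorder_inj_onI)
  fix i j assume ij: "i < j" "i \<in> {j. \<bar>T j\<bar> < 1/4}" "j \<in> {j. \<bar>T j\<bar> < 1/4}"
  show "\<nu> i \<noteq> \<nu> j"
  proof
    assume eq: "\<nu> i = \<nu> j"
    have "of_int (Q (\<nu> j)) * \<bar>s (Suc j)\<bar> < of_int (Q (\<nu> j)) * \<bar>s (Suc i)\<bar>"
      using Q_ge_1[of "\<nu> j"] abs_s_strict_antimono[of "Suc i" "Suc j"] ij by (intro mult_strict_left_mono) auto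
    also have "\<dots> = of_int \<bar>q (Suc i)\<bar> * \<bar>\<delta> (\<nu> j)\<bar>"
      using convergent_parallel[of i] ij eq by simp
    also have "\<dots> \<le> of_int \<bar>q (Suc j)\<bar> * \<bar>\<delta> (\<nu> j)\<bar>"
      using abs_q_mono[of "Suc i" "Suc j"] ij by (intro mult_right_mono) (auto simp only: of_int_le_iff abs_ge_zero Suc_le_mono less_imp_le)
    also have "\<dots> = of_int (Q (\<nu> j)) * \<bar>s (Suc j)\<bar>"
      using convergent_parallel[of j] ij by simp
    finally show False by simp
  qed
qed auto

section \<open>Weights that may be unbounded at 0\<close>

lemma summable_orbit_split:
  fixes h :: "real \<Rightarrow> real"
  assumes "\<alpha> > 0"
    and bdd: "\<And>y. 1/4 \<le> \<bar>y\<bar> \<Longrightarrow> \<bar>y\<bar> \<le> 1 \<Longrightarrow> \<bar>h y\<bar> \<le> B"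
    and diff: "h differentiable (at 1)" "h differentiable (at (-1))"
    and nonneg: "\<And>y. \<bar>y\<bar> \<le> 1 \<Longrightarrow> h y \<ge> 0"
    and F: "summable (\<lambda>n. F (Suc n))" "\<And>n. F n \<ge> 0" and "C \<ge> 0"
    and le: "\<And>j. \<bar>T j\<bar> < 1/4 \<Longrightarrow> \<bar>s j\<bar> powr \<alpha> * h (T j) \<le> C * F (\<nu> j)"
  shows "summable (\<lambda>j. orbit_phase x j * of_real (\<bar>s j\<bar> powr \<alpha> * h (T j)))"
proof -
  \<comment> \<open>Cutting off \<open>h\<close> below 1/4 leaves a bounded function that agrees
    with \<open>h\<close> near 1 and -1. The part cut off is summed absolutely through
    \<nu>.\<close>
  define \<Omega> :: "real \<Rightarrow> complex" where "\<Omega> y = (if 1/4 \<le> \<bar>y\<bar> then of_real (h y) else 0)" for y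
  have diff_\<Omega>: "\<Omega> differentiable (at c within {-1..1})" if h: "h differentiable (at c)" and c: "\<bar>c\<bar> = 1" for c
  proof -
    obtain h' where "(h has_derivative h') (at c)"
      using h unfolding differentiable_def by blast
    then have "((\<lambda>y. complex_of_real (h y)) has_derivative (\<lambda>y. of_real (h' y))) (at c within {-1..1})"
      by (rule has_derivative_of_real[OF has_derivative_at_withinI])
    then have "(\<Omega> has_derivative (\<lambda>y. of_real (h' y))) (at c within {-1..1})"
    proof (rule has_derivative_transform_within[where d="1/2"])
      fix y assume "dist y c < 1/2"
      then have "1/4 \<le> \<bar>y\<bar>" using c unfolding dist_real_def by linarith
      then show "of_real (h y) = \<Omega> y" by (simp add: \<Omega>_def)
    qed (use c in auto)
    then show ?thesis by (auto simp: differentiable_def)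
  qed
  have "bounded (\<Omega> ` {-1..1})"
    unfolding bounded_iff
  proof (intro exI ballI, elim imageE)
    fix z y assume "z = \<Omega> y" "y \<in> {-1..1}"
    then show "norm z \<le> \<bar>B\<bar>" using bdd[of y] by (simp add: \<Omega>_def abs_le_iff) linarith
  qed
  then have 1: "summable (\<lambda>j. orbit_phase x j * of_real (\<bar>s j\<bar> powr \<alpha>) * \<Omega> (T j))"
    using diff assms(1) by (intro summable_orbit_bounded diff_\<Omega>) auto
  \<comment> \<open>The hypothesis starts at index 1, but \<open>\<nu> j\<close> may be 0; one extra
    term is harmless.\<close>
  have "summable F" using F(1) by (simp add: summable_Suc_iff)
  then have "summable (\<lambda>j. if j \<in> {j. \<bar>T j\<bar> < 1/4} then \<bar>s j\<bar> powr \<alpha> * h (T j) else 0)"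
    using le nonneg F(2) \<open>C \<ge> 0\<close>
    by (intro summable_if_comparison_inj_on[OF inj_on_\<nu>, where F=F and C=C]) (auto simp: less_imp_le)
  then have "summable (\<lambda>j. orbit_phase x j * of_real (if j \<in> {j. \<bar>T j\<bar> < 1/4} then \<bar>s j\<bar> powr \<alpha> * h (T j) else 0))"
    by (rule summable_comparison_test'[where N=0]) (use nonneg in \<open>auto simp: norm_mult abs_mult less_imp_le\<close>)
  from summable_add[OF 1 this] show ?thesis
    by (rule summable_cong[THEN iffD1, rotated]) (auto intro!: always_eventually simp: \<Omega>_def)
qed

lemma summable_orbit_powr:
  assumes "\<alpha> > 0"
    and "summable (\<lambda>n. real_of_int (Q (Suc (Suc n))) powr \<beta> / real_of_int (Q (Suc n)) powr (\<alpha> + \<beta>))"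
  shows "summable (\<lambda>j. orbit_phase x j * of_real (\<bar>s j\<bar> powr \<alpha> / \<bar>T j\<bar> powr \<beta>))"
proof -
  define h :: "real \<Rightarrow> real" where "h y = \<bar>y\<bar> powr - \<beta>" for y
  have h_nonneg: "h y \<ge> 0" for y by (simp add: h_def)
  have h_has_deriv: "\<exists>D. (h has_real_derivative D) (at c)" if "c = 1 \<or> c = -1" for c
  proof -
    have "((\<lambda>y. (c * y) powr - \<beta>) has_real_derivative (- \<beta> * (c * c) powr (- \<beta> - 1) * c)) (at c)"
      using that by (auto intro!: derivative_eq_intros)
    then have "(h has_real_derivative (- \<beta> * (c * c) powr (- \<beta> - 1) * c)) (at c)"
      by (rule has_field_derivative_transform_within[where d=1])
        (use that in \<open>auto simp: h_def dist_real_def abs_if\<close>)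
    then show ?thesis by blast
  qed
  have h_diff: "h differentiable (at c)" if "c = 1 \<or> c = -1" for c
    using h_has_deriv[OF that] real_differentiable_def by blast
  have "summable (\<lambda>j. orbit_phase x j * of_real (\<bar>s j\<bar> powr \<alpha> * h (T j)))"
  proof (cases "\<beta> \<ge> 0")
    case True
    define F where "F n = real_of_int (Q (Suc n)) powr \<beta> / real_of_int (Q n) powr (\<alpha> + \<beta>)" for n
    show ?thesis
    proof (rule summable_orbit_split[where F=F and C="(4/3) powr (\<alpha> + \<beta>) * 2 powr \<beta>" and B="(1/4) powr - \<beta>"])
      show "\<bar>h y\<bar> \<le> (1/4) powr - \<beta>" if "1/4 \<le> \<bar>y\<bar>" for y
        using True that by (auto simp: h_def intro!: powr_mono2')
      fix j assume small: "\<bar>T j\<bar> < 1/4"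
      let ?a = "real_of_int (Q (\<nu> j))" and ?b = "real_of_int (Q (Suc (\<nu> j)))"
      have pos: "?a > 0" "?b > 0" using Q_ge_1[of "\<nu> j"] Q_ge_1[of "Suc (\<nu> j)"] by linarith+
      \<comment> \<open>Since \<open>\<bar>T j\<bar>\<close> is the ratio of consecutive
        \<open>\<bar>s\<bar>\<close>, an upper bound for \<open>\<bar>s j\<bar>\<close> and a lower
        bound for \<open>\<bar>s (Suc j)\<bar>\<close> suffice.\<close>
      have "\<bar>s j\<bar> powr \<alpha> * h (T j) = \<bar>s j\<bar> powr (\<alpha> + \<beta>) * \<bar>s (Suc j)\<bar> powr - \<beta>"
        by (simp add: h_def orbit_powr_Suc powr_add powr_minus field_simps)
      also have "\<dots> \<le> (4/3 / ?a) powr (\<alpha> + \<beta>) * (1 / (2 * ?b)) powr - \<beta>"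
        using True assms(1) pos abs_s_le[OF small] abs_s_Suc_ge[of j]
        by (intro mult_mono powr_mono2 powr_mono2') auto
      also have "\<dots> = (4/3) powr (\<alpha> + \<beta>) * 2 powr \<beta> * F (\<nu> j)"
        using pos by (simp add: F_def powr_divide powr_mult powr_minus_divide del: rcf_denom.simps)
      finally show "\<bar>s j\<bar> powr \<alpha> * h (T j) \<le> (4/3) powr (\<alpha> + \<beta>) * 2 powr \<beta> * F (\<nu> j)" .
    qed (use assms h_diff h_nonneg in \<open>auto simp: F_def\<close>)
  next
    case False
    \<comment> \<open>For negative \<beta> the weight is at most 1 on the whole interval, so the
      bounded case applies directly.\<close>
    have "summable (\<lambda>j. orbit_phase x j * of_real (\<bar>s j\<bar> powr \<alpha>) * complex_of_real (h (T j)))"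
    proof (rule summable_orbit_bounded)
      have "norm (complex_of_real (h y)) \<le> 1" if "y \<in> {-1..1}" for y
        using that False powr_mono2[of "-\<beta>" "\<bar>y\<bar>" 1] by (auto simp: h_def)
      then show "bounded ((\<lambda>y. complex_of_real (h y)) ` {-1..1})"
        unfolding bounded_iff by blast
      show "(\<lambda>y. complex_of_real (h y)) differentiable (at 1 within {-1..1})"
        "(\<lambda>y. complex_of_real (h y)) differentiable (at (-1) within {-1..1})"
        using h_diff[of 1] h_diff[of "-1"] unfolding differentiable_def
        by (blast intro: has_derivative_of_real has_derivative_at_withinI)+
    qed (rule assms(1))
    then show ?thesis by (simp add: mult.assoc)
  qed
  then show ?thesis by (simp add: h_def powr_minus_divide)
qed

lemma summable_orbit_ln:
  assumes "\<alpha> > 0"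
    and "summable (\<lambda>n. ln (real_of_int (Q (Suc (Suc n)))) / real_of_int (Q (Suc n)) powr \<alpha>)"
  shows "summable (\<lambda>j. orbit_phase x j * of_real (\<bar>s j\<bar> powr \<alpha> * ln (1 / \<bar>T j\<bar>)))"
proof -
  define h :: "real \<Rightarrow> real" where "h y = ln (1 / \<bar>y\<bar>)" for y
  \<comment> \<open>The summand 1 absorbs the additive constant \<open>ln (8/3)\<close> that arises
    below, where \<open>1 / \<bar>T j\<bar>\<close> is bounded by \<open>4/3 * 2\<close> times the
    next denominator.\<close>
  define F where "F n = (1 + ln (real_of_int (Q (Suc n)))) / real_of_int (Q n) powr \<alpha>" for n
  have h_diff: "h differentiable (at c)" if "c = 1 \<or> c = -1" for c
  proof -
    have "c * c = 1" using that by auto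
    then have "((\<lambda>y. - ln (c * y)) has_real_derivative (- c)) (at c)"
      by (auto intro!: derivative_eq_intros)
    then have "(h has_real_derivative (- c)) (at c)"
      by (rule has_field_derivative_transform_within[where d=1])
        (use that in \<open>auto simp: h_def dist_real_def abs_if ln_div\<close>)
    then show ?thesis using real_differentiable_def by blast
  qed
  have ln_ge: "ln 2 \<le> ln (real_of_int (Q (Suc (Suc n))))" for n
    using Q_Suc_ge[of "Suc n"] by (subst ln_le_cancel_iff) (simp_all del: rcf_denom.simps)
  have "summable (\<lambda>n. F (Suc n))"
  proof (rule summable_comparison_test'[where N=0])
    show "summable (\<lambda>n. (1 / ln 2 + 1) * (ln (real_of_int (Q (Suc (Suc n)))) / real_of_int (Q (Suc n)) powr \<alpha>))"
      by (intro summable_mult assms)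
    fix n
    let ?L = "ln (real_of_int (Q (Suc (Suc n))))"
    have L: "?L \<ge> 0" using ln_ge[of n] by (rule order_trans[rotated]) simp
    \<comment> \<open>As \<open>?L\<close> is at least \<open>ln 2\<close>, the extra 1 costs only a
      constant factor.\<close>
    have "1 + ?L \<le> (1 / ln 2 + 1) * ?L"
      using ln_ge[of n] by (simp add: field_simps)
    then have "(1 + ?L) / real_of_int (Q (Suc n)) powr \<alpha> \<le> (1 / ln 2 + 1) * ?L / real_of_int (Q (Suc n)) powr \<alpha>"
      by (rule divide_right_mono) simp
    then show "norm (F (Suc n)) \<le> (1 / ln 2 + 1) * (?L / real_of_int (Q (Suc n)) powr \<alpha>)"
      using L by (simp add: F_def del: rcf_denom.simps)
  qed
  moreover have F_nonneg: "F n \<ge> 0" for n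
    using Q_ge_1[of "Suc n"] by (simp add: F_def)
  ultimately have "summable (\<lambda>j. orbit_phase x j * of_real (\<bar>s j\<bar> powr \<alpha> * h (T j)))"
  proof (intro summable_orbit_split[where F=F and C="(4/3) powr \<alpha> * (ln (8/3) + 1)" and B="ln 4"])
    show "\<bar>h y\<bar> \<le> ln 4" if "1/4 \<le> \<bar>y\<bar>" "\<bar>y\<bar> \<le> 1" for y
    proof -
      have "\<bar>y\<bar> > 0" using that by linarith
      then have "1 \<le> 1 / \<bar>y\<bar>" "1 / \<bar>y\<bar> \<le> 4" using that by (auto simp: divide_le_eq)
      moreover from this have "ln (1 / \<bar>y\<bar>) \<le> ln 4" by (subst ln_le_cancel_iff) auto
      ultimately show ?thesis by (simp add: h_def)
    qed
    show "h y \<ge> 0" if "\<bar>y\<bar> \<le> 1" for y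
      using that by (cases "y = 0") (auto simp: h_def)
    fix j assume small: "\<bar>T j\<bar> < 1/4"
    let ?a = "real_of_int (Q (\<nu> j))" and ?b = "real_of_int (Q (Suc (\<nu> j)))"
    have pos: "?a \<ge> 1" "?b \<ge> 1" using Q_ge_1[of "\<nu> j"] Q_ge_1[of "Suc (\<nu> j)"] by linarith+
    have "\<bar>s j\<bar> \<le> 4/3 / ?a" by (rule abs_s_le[OF small])
    also have "\<dots> \<le> 4/3" using pos by (simp add: field_simps)
    finally have "\<bar>s j\<bar> \<le> 4/3" .
    moreover have "1 / \<bar>s (Suc j)\<bar> \<le> 2 * ?b"
      using abs_s_Suc_ge[of j] pos by (simp add: field_simps)
    ultimately have "\<bar>s j\<bar> * (1 / \<bar>s (Suc j)\<bar>) \<le> 4/3 * (2 * ?b)"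
      by (intro mult_mono) auto
    moreover have "1 / \<bar>T j\<bar> = \<bar>s j\<bar> * (1 / \<bar>s (Suc j)\<bar>)" by (simp add: orbit_prod_Suc abs_mult)
    ultimately have "h (T j) \<le> ln (8/3 * ?b)"
      unfolding h_def using pos by (subst ln_le_cancel_iff) auto
    also have "\<dots> = ln (8/3) + ln ?b" using pos by (subst ln_mult) auto
    also have "\<dots> \<le> (ln (8/3) + 1) * (1 + ln ?b)"
      using pos by (simp add: algebra_simps)
    finally have "h (T j) \<le> (ln (8/3) + 1) * (1 + ln ?b)" .
    moreover have "h (T j) \<ge> 0" by (simp add: h_def less_imp_le)
    moreover have "\<bar>s j\<bar> powr \<alpha> \<le> (4/3 / ?a) powr \<alpha>"
      using assms(1) abs_s_le[OF small] by (intro powr_mono2) auto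
    ultimately have "\<bar>s j\<bar> powr \<alpha> * h (T j) \<le> (4/3 / ?a) powr \<alpha> * ((ln (8/3) + 1) * (1 + ln ?b))"
      by (intro mult_mono) auto
    also have "\<dots> = (4/3) powr \<alpha> * (ln (8/3) + 1) * F (\<nu> j)"
      using pos by (simp add: F_def powr_divide powr_mult del: rcf_denom.simps)
    finally show "\<bar>s j\<bar> powr \<alpha> * h (T j) \<le> (4/3) powr \<alpha> * (ln (8/3) + 1) * F (\<nu> j)" .
  qed (use assms h_diff in auto)
  then show ?thesis by (simp add: h_def)
qed

end

theorem theorem5:
  fixes x :: real
  assumes "0 < x" and "x < 1" and "x \<notin> \<rat>"
  shows
    "(\<forall>(\<Omega> :: real \<Rightarrow> complex) (\<alpha> :: real).
        bounded (\<Omega> ` {-1..1}) \<longrightarrow>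
        \<Omega> differentiable (at 1 within {-1..1}) \<longrightarrow>
        \<Omega> differentiable (at (-1) within {-1..1}) \<longrightarrow>
        \<alpha> > 0 \<longrightarrow>
        summable (\<lambda>j. orbit_phase x (Suc j) *
          of_real (\<bar>orbit_prod x (Suc j)\<bar> powr \<alpha>) * \<Omega> ((even_map ^^ Suc j) x)))
     \<and> (\<forall>(\<alpha> :: real) (\<beta> :: real).
        \<alpha> > 0 \<longrightarrow>
        summable (\<lambda>n. real_of_int (rcf_denom x (Suc (Suc n))) powr \<beta> /
          real_of_int (rcf_denom x (Suc n)) powr (\<alpha> + \<beta>)) \<longrightarrow>
        summable (\<lambda>j. orbit_phase x j *
          of_real (\<bar>orbit_prod x j\<bar> powr \<alpha> / \<bar>(even_map ^^ j) x\<bar> powr \<beta>)))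
     \<and> (\<forall>\<alpha> :: real.
        \<alpha> > 0 \<longrightarrow>
        summable (\<lambda>n. ln (real_of_int (rcf_denom x (Suc (Suc n)))) /
          real_of_int (rcf_denom x (Suc n)) powr \<alpha>) \<longrightarrow>
        summable (\<lambda>j. orbit_phase x j *
          of_real (\<bar>orbit_prod x j\<bar> powr \<alpha> * ln (1 / \<bar>(even_map ^^ j) x\<bar>))))"
proof -
  interpret irrational_orbit x by unfold_locales (use assms in auto)
  \<comment> \<open>Series (i) starts at j = 1, hence the index shift; the others start at
    0.\<close>
  show ?thesis
    using summable_orbit_bounded[THEN summable_Suc_iff[THEN iffD2]]
      summable_orbit_powr summable_orbit_ln by blast
qed

end
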